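(* Let $n,k$ and $t$ be positive integers with $n\geq 2k$ and $t\geq 2$. If $\mathscr{A}_1,\mathscr{A}_2,\dots,\mathscr{A}_t\subseteq \binom{[n]}{k}$ are non-empty cross-intersecting families, then $$\sum_{i=1}^t|\mathscr{A}_i|\leq \max\left\{\binom{n}{k}-\binom{n-k}{k}+t-1,\ t\binom{n-1}{k-1}\right\},$$ and the upper bound is sharp, i.e. for all such $n,k,t$ there exist non-empty cross-intersecting families $\mathscr{A}_1,\dots,\mathscr{A}_t\subseteq\binom{[n]}{k}$ for which equality holds.
   Context: $[n]=\{1,2,\dots,n\}$, and $\binom{[n]}{k}$ denotes the collection of all $k$-element subsets of $[n]$. Families $\mathscr{A}_1,\dots,\mathscr{A}_t$ ($t\ge 2$) of subsets of $[n]$ are called cross-intersecting if $A_i\cap A_j\neq\emptyset$ for all $A_i\in\mathscr{A}_i$ and $A_j\in\mathscr{A}_j$ with $i\neq j$. "Non-empty" means that each $\mathscr{A}_i$ is a non-empty family. *)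

theory Defs
  imports Main "HOL-Library.Ramsey"
begin

text \<open>
  A sequence of families \<open>\<A>\<^sub>1, \<dots>, \<A>\<^sub>t\<close> is a function on indices of which only the values on
  \<open>{1..t}\<close> matter. The families need not be distinct, and no family is required to be
  intersecting in itself.
\<close>

definition cross_intersecting :: "nat \<Rightarrow> (nat \<Rightarrow> 'a set set) \<Rightarrow> bool" where
  "cross_intersecting t \<A> \<longleftrightarrow>
     (\<forall>i\<in>{1..t}. \<forall>j\<in>{1..t}. i \<noteq> j \<longrightarrow> (\<forall>A\<in>\<A> i. \<forall>B\<in>\<A> j. A \<inter> B \<noteq> {}))"

text \<open>
  The collection of \<open>k\<close>-element subsets of \<open>{1..n}\<close> is \<^term>\<open>nsets {1..n} k\<close>.
\<close>

definition nonempty_cross_intersecting_families ::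
    "nat \<Rightarrow> nat \<Rightarrow> nat \<Rightarrow> (nat \<Rightarrow> nat set set) \<Rightarrow> bool" where
  "nonempty_cross_intersecting_families n k t \<A> \<longleftrightarrow>
     (\<forall>i\<in>{1..t}. \<A> i \<subseteq> nsets {1..n} k \<and> \<A> i \<noteq> {}) \<and> cross_intersecting t \<A>"

end

theory Submission
  imports Defs Complex_Main
begin

text \<open>
  For a non-empty family \<open>B\<close> of \<open>l\<close>-subsets of an \<open>n\<close>-set with \<open>n \<ge> k + l\<close>, the number of
  \<open>k\<close>-sets disjoint from some member of \<open>B\<close> is bounded below by the concave piecewise linear function
  of \<open>card B\<close> through the points given by a single set, by a full star and by all \<open>l\<close>-sets. This weak
  form of the Kruskal-Katona theorem is proved by induction: choose a point \<open>x\<close> of at least average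
  degree \<open>l * card B / n\<close> and apply the induction hypothesis to the link of \<open>x\<close>, with parameters
  \<open>(n - 1, l - 1, k)\<close>, and to the sets avoiding \<open>x\<close>, with parameters \<open>(n - 1, l, k - 1)\<close>; the gap
  \<open>n - k - l\<close> is unchanged.

  If \<open>A\<^sub>i\<close> is a largest family and \<open>A\<^sub>j\<close> a largest one among the others, the sum of all sizes is at most
  \<open>card A\<^sub>i + (t - 1) * card A\<^sub>j\<close>. Since \<open>card A\<^sub>j \<le> card A\<^sub>i\<close>, the family \<open>A\<^sub>j\<close> is at most as large as a
  star, so the bound leaves a linear function of \<open>card A\<^sub>j\<close>, which is maximal at an end point of the
  range: a single set or a full star.
\<close>

section \<open>Monotone ratios and sums of binomial coefficients\<close>

lemma binomial_Suc_ratio: "Suc m * (j choose Suc m) = (j - m) * (j choose m)"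
  by (simp only: binomial_absorption binomial_absorb_comp)

lemma binomial_gt_1:
  assumes "0 < m" "m < j"
  shows "1 < (j choose m)"
proof -
  obtain j' m' where "j = Suc j'" "m = Suc m'" using assms by (cases j; cases m) auto
  moreover from this have "0 < j' choose m'" "0 < j' choose Suc m'" using assms by auto
  ultimately show ?thesis by (simp only: binomial_Suc_Suc)
qed

text \<open>Raising \<open>h\<close> by one multiplies \<open>(j - h) choose k\<close> by
  \<open>(j - h - k) / (j - h)\<close> and \<open>(j - h) choose (l - h)\<close> by
  \<open>(l - h) / (j - h)\<close>. The first factor is at least the second because
  \<open>k + l \<le> j\<close>, so the quotient of the two coefficients does not decrease.\<close>

lemma binomial_ratio_mono:
  assumes "k + l \<le> j" "i \<le> h" "h \<le> l"
  shows "((j - i) choose k) * ((j - h) choose (l - h)) \<le> ((j - h) choose k) * ((j - i) choose (l - i))"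
  using assms(2,3)
proof (induction h rule: dec_induct)
  case base
  show ?case by simp
next
  case (step h)
  define m where "m = j - Suc h"
  define r where "r = l - Suc h"
  have m: "j - h = Suc m" "l - h = Suc r" "k + r \<le> m"
    using step.prems assms(1) by (auto simp: m_def r_def)
  have k1: "Suc m * (m choose k) = (Suc m - k) * (Suc m choose k)"
    using binomial_absorb_comp[of "Suc m" k] by simp
  have r1: "Suc r * (Suc m choose Suc r) = Suc m * (m choose r)"
    by (rule Suc_times_binomial)
  let ?X = "(j - i) choose k" and ?Y = "(j - i) choose (l - i)"
  have IH: "?X * (Suc m choose Suc r) \<le> (Suc m choose k) * ?Y"
    using step.IH step.prems m by simp
  have "Suc m * (?X * (m choose r)) = Suc r * (?X * (Suc m choose Suc r))"
    using r1 by (metis mult.left_commute)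
  also have "\<dots> \<le> (Suc m - k) * ((Suc m choose k) * ?Y)"
    by (rule mult_le_mono) (use IH m in auto)
  also have "\<dots> = Suc m * ((m choose k) * ?Y)"
    using k1 by (metis mult.assoc)
  finally have "?X * (m choose r) \<le> (m choose k) * ?Y" by (simp only: Suc_mult_le_cancel1)
  then show ?case by (simp add: m_def r_def)
qed

lemma sum_binomial_lower:
  assumes "l \<le> j"
  shows "(\<Sum>i<l. real ((j - i) choose k)) = real (Suc j choose Suc k) - real (Suc (j - l) choose Suc k)"
  using assms
proof (induction l)
  case (Suc l)
  then have "j - l = Suc (j - Suc l)" by auto
  with Suc show ?case by simp
qed simp

lemma sum_binomial_diagonal:
  assumes "l \<le> j"
  shows "(\<Sum>i<l. real ((j - i) choose (l - i))) = real (Suc j choose l) - 1"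
  using assms
proof (induction l arbitrary: j)
  case (Suc l)
  then obtain j' where j: "j = Suc j'" "l \<le> j'" by (cases j) auto
  show ?case using Suc.IH[OF j(2)] by (simp add: sum.lessThan_Suc_shift j(1) del: sum.lessThan_Suc)
qed simp

text \<open>Chebyshev's sum inequality, cross-multiplied: in the double sum of
  \<open>(w i - w h) * (x i * y h - x h * y i)\<close> the two factors never have opposite signs,
  and expanding it gives twice the difference of the two sides.\<close>

lemma chebyshev_ratio:
  fixes x y w :: "nat \<Rightarrow> real"
  assumes "\<And>i h. i \<le> h \<Longrightarrow> h < l \<Longrightarrow> x i * y h \<le> x h * y i"
    and "\<And>i h. i \<le> h \<Longrightarrow> h < l \<Longrightarrow> w i \<le> w h"
  shows "(\<Sum>i<l. x i) * (\<Sum>i<l. w i * y i) \<le> (\<Sum>i<l. w i * x i) * (\<Sum>i<l. y i)"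
proof -
  have nonneg: "0 \<le> (w i - w h) * (x i * y h - x h * y i)" if "i < l" "h < l" for i h
  proof (cases "i \<le> h")
    case True
    then show ?thesis using assms that by (intro mult_nonpos_nonpos) auto
  next
    case False
    then show ?thesis using assms[of h i] that by (intro mult_nonneg_nonneg) auto
  qed
  let ?T = "\<lambda>f. \<Sum>i<l. \<Sum>h<l. (f i h :: real)"
  have "0 \<le> ?T (\<lambda>i h. (w i - w h) * (x i * y h - x h * y i))"
    by (intro sum_nonneg nonneg) auto
  also have "\<dots> = ?T (\<lambda>i h. w i * x i * y h) - ?T (\<lambda>i h. w i * y i * x h)
      - ?T (\<lambda>i h. x i * (w h * y h)) + ?T (\<lambda>i h. y i * (w h * x h))"
    by (simp add: sum_subtractf[symmetric] sum.distrib[symmetric] algebra_simps)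
  also have "\<dots> = 2 * ((\<Sum>i<l. w i * x i) * (\<Sum>i<l. y i) - (\<Sum>i<l. x i) * (\<Sum>i<l. w i * y i))"
  proof -
    have "?T (\<lambda>i h. w i * x i * y h) = (\<Sum>i<l. w i * x i) * (\<Sum>i<l. y i)"
      and "?T (\<lambda>i h. w i * y i * x h) = (\<Sum>i<l. w i * y i) * (\<Sum>i<l. x i)"
      and "?T (\<lambda>i h. x i * (w h * y h)) = (\<Sum>i<l. x i) * (\<Sum>i<l. w i * y i)"
      and "?T (\<lambda>i h. y i * (w h * x h)) = (\<Sum>i<l. y i) * (\<Sum>i<l. w i * x i)"
      by (simp_all only: sum_product)
    then show ?thesis by (simp add: mult.commute)
  qed
  finally show ?thesis by simp
qed

section \<open>Slopes of the piecewise linear bound\<close>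

text \<open>
  The slopes of the two segments from \<open>(1, (n - l) choose k)\<close> via
  \<open>((n - 1) choose (l - 1), (n - 1) choose k)\<close> to \<open>(n choose l, n choose k)\<close>. The abscissa of the
  middle point is written as \<open>(n choose l) - ((n - 1) choose l)\<close>, and likewise for \<open>k\<close> in the second
  slope, so that it is correct for \<open>l = 0\<close> or \<open>k = 0\<close>, where \<open>l - 1\<close> truncates.
  Degenerate segments get slope \<open>0\<close> by division by zero.
\<close>

definition low_slope :: "nat \<Rightarrow> nat \<Rightarrow> nat \<Rightarrow> real" where
  "low_slope n l k = (real ((n - 1) choose k) - real ((n - l) choose k))
     / (real (n choose l) - real ((n - 1) choose l) - 1)"

definition up_slope :: "nat \<Rightarrow> nat \<Rightarrow> nat \<Rightarrow> real" where
  "up_slope n l k = (real (n choose k) - real ((n - 1) choose k)) / real ((n - 1) choose l)"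

text \<open>One implication per segment, so that both are available at the breakpoint. Real
  arguments keep the differences free of truncation.\<close>

definition disjoint_bound :: "nat \<Rightarrow> nat \<Rightarrow> nat \<Rightarrow> real \<Rightarrow> real \<Rightarrow> bool" where
  "disjoint_bound n l k b y \<longleftrightarrow>
     (b \<le> real (n choose l) - real ((n - 1) choose l) \<longrightarrow>
        real ((n - l) choose k) + low_slope n l k * (b - 1) \<le> y) \<and>
     (real (n choose l) - real ((n - 1) choose l) \<le> b \<longrightarrow>
        real (n choose k) - up_slope n l k * (real (n choose l) - b) \<le> y)"

section \<open>Estimates for the lower slope\<close>

text \<open>Hockey-stick sums over a common index: for \<open>l > 0\<close> the slope becomes a
  weighted mean of the ratios \<open>((j - i) choose k) / ((j - i) choose (l - i))\<close>, which do
  not decrease with \<open>i\<close>.\<close>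

lemma low_slope_eq:
  assumes "l \<le> j"
  shows "low_slope (Suc (Suc j)) (Suc l) (Suc k) =
    (\<Sum>i<l. real ((j - i) choose k)) / (\<Sum>i<l. real ((j - i) choose (l - i)))"
  unfolding sum_binomial_lower[OF assms] sum_binomial_diagonal[OF assms] low_slope_def
  using assms by (simp add: Suc_diff_le)

lemma sum_diagonal_pos:
  assumes "0 < l" "l \<le> j"
  shows "0 < (\<Sum>i<l. real ((j - i) choose (l - i)))"
  using assms by (intro sum_pos) auto

text \<open>The mean is at most its last ratio, the one for \<open>i = l - 1\<close>, and by
  absorption this equals \<open>((j - l) choose k) / (j - l + 1 - k)\<close>.\<close>

lemma low_slope_le:
  assumes "k + l \<le> j" "0 < l"
  shows "low_slope (Suc (Suc j)) (Suc l) (Suc k) * real (Suc j - l - k) \<le> real ((j - l) choose k)"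
proof -
  have "real (Suc j - l - k) * real ((j - i) choose k) \<le> real ((j - l) choose k) * real ((j - i) choose (l - i))"
    if "i < l" for i
  proof -
    define m where "m = j - l"
    have e: "j - (l - 1) = Suc m" "l - (l - 1) = 1" "Suc j - l - k = Suc m - k"
      using assms by (auto simp: m_def)
    have a: "((j - i) choose k) * Suc m \<le> (Suc m choose k) * ((j - i) choose (l - i))"
      using binomial_ratio_mono[OF assms(1), of i "l - 1"] that e by simp
    have b: "Suc m * (m choose k) = (Suc m - k) * (Suc m choose k)"
      using binomial_absorb_comp[of "Suc m" k] by simp
    have "Suc m * ((Suc m - k) * ((j - i) choose k)) = (Suc m - k) * (((j - i) choose k) * Suc m)"
      by (simp only: mult_ac)
    also have "\<dots> \<le> (Suc m - k) * ((Suc m choose k) * ((j - i) choose (l - i)))"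
      using a by (intro mult_le_mono2)
    also have "\<dots> = Suc m * ((m choose k) * ((j - i) choose (l - i)))"
      using b by (metis mult.assoc)
    finally have "(Suc m - k) * ((j - i) choose k) \<le> (m choose k) * ((j - i) choose (l - i))"
      by (simp only: Suc_mult_le_cancel1)
    then show ?thesis unfolding e m_def of_nat_mult[symmetric] of_nat_le_iff .
  qed
  then have "real (Suc j - l - k) * (\<Sum>i<l. real ((j - i) choose k))
      \<le> real ((j - l) choose k) * (\<Sum>i<l. real ((j - i) choose (l - i)))"
    unfolding sum_distrib_left by (intro sum_mono) auto
  then show ?thesis
    using sum_diagonal_pos[OF assms(2), of j] assms(1)
    by (simp add: low_slope_eq divide_simps mult.commute)
qed

text \<open>Up to the factor \<open>k / (j - l)\<close>, the slope on the right is the mean from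
  \<open>low_slope_eq\<close> with its terms reweighted by \<open>1 / (j - i)\<close>. These weights
  grow with \<open>i\<close>, as the ratios do, so by Chebyshev the reweighted mean is at least the
  original one.\<close>

lemma low_slope_deletion_ge:
  assumes "k + l \<le> j"
  shows "real k * low_slope (Suc (Suc j)) (Suc l) (Suc k) \<le> real (j - l) * low_slope (Suc j) (Suc l) k"
proof (cases "k = 0 \<or> l = 0")
  case True
  then show ?thesis using assms by (auto simp: low_slope_def)
next
  case False
  define x where "x = (\<lambda>i. real ((j - i) choose k))"
  define y where "y = (\<lambda>i. real ((j - i) choose (l - i)))"
  define w where "w = (\<lambda>i. 1 / real (j - i))"
  obtain j' k' where jk: "j = Suc j'" "k = Suc k'" "k' + l \<le> j'"
    using False assms by (cases j; cases k) auto
  have wx: "real k * (\<Sum>i<l. w i * x i) = (\<Sum>i<l. real ((j' - i) choose k'))"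
    unfolding sum_distrib_left
  proof (rule sum.cong)
    fix i assume "i \<in> {..<l}"
    then obtain m where m: "j - i = Suc m" "j' - i = m" using jk by (auto simp: Suc_diff_le)
    have "real (Suc m) * real (m choose k') = real (Suc m choose Suc k') * real (Suc k')"
      by (metis Suc_times_binomial_eq of_nat_mult)
    then show "real k * (w i * x i) = real ((j' - i) choose k')"
      unfolding w_def x_def m jk(2)
      by (simp add: divide_simps mult.commute del: binomial_Suc_Suc of_nat_Suc)
  qed simp
  have wy: "real (j - l) * (\<Sum>i<l. w i * y i) = (\<Sum>i<l. real ((j' - i) choose (l - i)))"
    unfolding sum_distrib_left
  proof (rule sum.cong)
    fix i assume i: "i \<in> {..<l}"
    then have e: "j - i = Suc (j' - i)" "Suc (j' - i) - (l - i) = j - l" using jk by auto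
    have "real (j - l) * real (Suc (j' - i) choose (l - i)) = real (Suc (j' - i)) * real ((j' - i) choose (l - i))"
      using binomial_absorb_comp[of "Suc (j' - i)" "l - i"]
      unfolding of_nat_mult[symmetric] by (simp only: e(2) diff_Suc_1)
    then show "real (j - l) * (w i * y i) = real ((j' - i) choose (l - i))"
      unfolding w_def y_def e by (simp add: divide_simps mult.commute del: binomial_Suc_Suc of_nat_Suc)
  qed simp
  have wypos: "0 < (\<Sum>i<l. w i * y i)" and ypos: "0 < (\<Sum>i<l. y i)"
    using False assms by (auto intro!: sum_pos mult_pos_pos simp: w_def y_def)
  have jl: "0 < real (j - l)" using jk by auto
  have cheb: "(\<Sum>i<l. x i) * (\<Sum>i<l. w i * y i) \<le> (\<Sum>i<l. w i * x i) * (\<Sum>i<l. y i)"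
  proof (rule chebyshev_ratio)
    fix i h assume "i \<le> h" "h < l"
    then show "x i * y h \<le> x h * y i"
      unfolding x_def y_def of_nat_mult[symmetric] of_nat_le_iff
      using binomial_ratio_mono[OF assms] by simp
    show "w i \<le> w h"
      unfolding w_def using \<open>i \<le> h\<close> \<open>h < l\<close> jk by (auto simp: divide_simps)
  qed
  have "low_slope (Suc j) (Suc l) k =
      (real k * (\<Sum>i<l. w i * x i)) / (real (j - l) * (\<Sum>i<l. w i * y i))"
  proof -
    have "(\<Sum>i<l. real ((j' - i) choose (l - i))) = real (Suc j' choose l) - 1"
      using sum_binomial_diagonal[of l j'] jk by auto
    moreover have "l \<le> j'" using jk by auto
    ultimately show ?thesis
      unfolding wx wy using low_slope_eq[of l j' k'] unfolding jk by simp
  qed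
  moreover have "low_slope (Suc (Suc j)) (Suc l) (Suc k) = (\<Sum>i<l. x i) / (\<Sum>i<l. y i)"
    using low_slope_eq[of l j k] assms by (simp add: x_def y_def)
  moreover have "(\<Sum>i<l. x i) / (\<Sum>i<l. y i) \<le> (\<Sum>i<l. w i * x i) / (\<Sum>i<l. w i * y i)"
    using cheb wypos ypos by (simp add: divide_simps mult.commute)
  moreover have "c * (d * X / (c * Y)) = d * (X / Y)" if "0 < c" for c d X Y :: real
    using that by simp
  ultimately show ?thesis using jl
    by (simp only:) (intro mult_left_mono of_nat_0_le_iff)
qed

text \<open>Here \<open>\<alpha>\<close> is the ratio at \<open>i = 0\<close>, the smallest one, so
  it is at most the mean. The slope \<open>low_slope (Suc j) l (Suc k)\<close> is the mean with that
  smallest ratio left out.\<close>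

lemma low_slope_link_ge:
  assumes "k + l \<le> j"
  defines "\<alpha> \<equiv> real (j choose k) / real (j choose l)"
  shows "0 < l \<Longrightarrow> \<alpha> \<le> low_slope (Suc (Suc j)) (Suc l) (Suc k)"
    and "2 \<le> l \<Longrightarrow> low_slope (Suc (Suc j)) (Suc l) (Suc k) \<le> low_slope (Suc j) l (Suc k)"
proof -
  define x where "x = (\<lambda>i. real ((j - i) choose k))"
  define y where "y = (\<lambda>i. real ((j - i) choose (l - i)))"
  have xy: "x 0 * y h \<le> x h * y 0" if "h < l" for h
    unfolding x_def y_def of_nat_mult[symmetric] of_nat_le_iff
    using binomial_ratio_mono[OF assms(1), of 0 h] that by simp
  have y0: "0 < y 0" using assms by (simp add: y_def)
  have \<alpha>: "\<alpha> = x 0 / y 0" by (simp add: \<alpha>_def x_def y_def)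
  have eq: "low_slope (Suc (Suc j)) (Suc l) (Suc k) = (\<Sum>i<l. x i) / (\<Sum>i<l. y i)"
    using low_slope_eq[of l j k] assms by (simp add: x_def y_def)
  show "\<alpha> \<le> low_slope (Suc (Suc j)) (Suc l) (Suc k)" if "0 < l"
  proof -
    have "x 0 * (\<Sum>i<l. y i) \<le> (\<Sum>i<l. x i) * y 0"
      unfolding sum_distrib_left sum_distrib_right by (intro sum_mono xy) auto
    then show ?thesis
      using sum_diagonal_pos[OF that, of j] assms(1) y0
      unfolding eq \<alpha> y_def by (simp add: divide_simps mult.commute)
  qed
  show "low_slope (Suc (Suc j)) (Suc l) (Suc k) \<le> low_slope (Suc j) l (Suc k)" if "2 \<le> l"
  proof -
    define l' j' where "l' = l - 1" and "j' = j - 1"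
    then have lj: "l = Suc l'" "j = Suc j'" "0 < l'" "l' \<le> j'"
      using that assms(1) by auto
    have s1: "(\<Sum>i<l. x i) = x 0 + (\<Sum>i<l'. x (Suc i))" "(\<Sum>i<l. y i) = y 0 + (\<Sum>i<l'. y (Suc i))"
      unfolding lj(1) by (simp_all add: sum.lessThan_Suc_shift del: sum.lessThan_Suc)
    have eq1: "low_slope (Suc j) l (Suc k) = (\<Sum>i<l'. x (Suc i)) / (\<Sum>i<l'. y (Suc i))"
      using low_slope_eq[OF lj(4), of k] unfolding lj x_def y_def by simp
    have pos: "0 < (\<Sum>i<l'. y (Suc i))"
      using sum_diagonal_pos[OF lj(3,4)] unfolding lj y_def by simp
    have "x 0 * (\<Sum>i<l'. y (Suc i)) \<le> (\<Sum>i<l'. x (Suc i)) * y 0"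
      unfolding sum_distrib_left sum_distrib_right using lj(1) by (intro sum_mono xy) auto
    then show ?thesis
      unfolding eq eq1 s1 using pos y0 by (simp add: divide_simps add_pos_pos algebra_simps)
  qed
qed

text \<open>The right side counts disjoint pairs of an \<open>l\<close>-set and a
  \<open>k\<close>-set; every \<open>k\<close>-set occurs in such a pair since
  \<open>k + l \<le> j\<close>.\<close>

lemma binomial_le_mult:
  assumes "k + l \<le> j"
  shows "(j choose k) \<le> (j choose l) * ((j - l) choose k)"
proof -
  have "(j choose (k + l)) * ((k + l) choose l) = (j choose l) * ((j - l) choose k)"
    using choose_mult[of l "k + l" j] assms by simp
  moreover have "(j choose (k + l)) * ((k + l) choose k) = (j choose k) * ((j - k) choose l)"
    using choose_mult[of k "k + l" j] assms by simp
  moreover have "(k + l) choose l = (k + l) choose k"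
    using binomial_symmetric[of l "k + l"] by simp
  moreover have "0 < (j - k) choose l" using assms by simp
  ultimately show ?thesis by (metis mult_le_mono2 mult.right_neutral One_nat_def Suc_leI)
qed

section \<open>The inductive step as a real inequality\<close>

text \<open>
  Here \<open>\<alpha>\<close>, \<open>\<beta>\<close>, \<open>\<gamma>\<close> are the upper slopes of the link, of the deletion and of the whole family, and
  \<open>\<sigma>1\<close>, \<open>\<sigma>0\<close>, \<open>\<sigma>\<close> the lower ones. The critical case is that both the link and the deletion lie on
  their lower segments: the claim is then linear in the two sizes and is checked at the ends
  \<open>b1 = 1\<close> and \<open>b1 = s\<close> of the ray where the degree condition is tight.
\<close>

lemma disjoint_bound_step:
  fixes j k l b0 b1 :: nat and y0 y1 :: real
  assumes jkl: "k + l \<le> j"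
    and b1: "1 \<le> b1" "b1 \<le> (Suc j choose l)"
    and b0: "b0 \<le> (Suc j choose Suc l)"
    and deg: "Suc l * (b1 + b0) \<le> Suc (Suc j) * b1"
    and y1: "disjoint_bound (Suc j) l (Suc k) (real b1) y1"
    and y0: "0 < b0 \<Longrightarrow> disjoint_bound (Suc j) (Suc l) k (real b0) y0" "b0 = 0 \<Longrightarrow> 0 \<le> y0"
  shows "disjoint_bound (Suc (Suc j)) (Suc l) (Suc k) (real (b1 + b0)) (y1 + y0)"
proof -
  \<comment> \<open>The breakpoints are \<open>s\<close> for the link, \<open>p\<close> for the
    deletion and \<open>p + s\<close> for the whole family, with values \<open>z\<close>,
    \<open>q\<close> and \<open>z + q\<close>. At a single set the bounds are \<open>e\<close>,
    \<open>u\<close> and \<open>e\<close>. Defining \<open>s\<close> and \<open>v\<close> as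
    differences makes them \<open>0\<close> for \<open>l = 0\<close> and
    \<open>k = 0\<close>.\<close>
  define p where "p = real (j choose l)"
  define q where "q = real (j choose k)"
  define s where "s = real (Suc j choose l) - p"
  define e where "e = real ((Suc j - l) choose Suc k)"
  define z where "z = real (j choose Suc k)"
  define u where "u = real ((j - l) choose k)"
  define w where "w = real (j choose Suc l)"
  define v where "v = real (Suc j choose k) - q"
  define \<alpha> where "\<alpha> = q / p"
  define \<beta> where "\<beta> = v / w"
  define \<gamma> where "\<gamma> = (q + v) / (p + w)"
  define \<sigma> where "\<sigma> = low_slope (Suc (Suc j)) (Suc l) (Suc k)"
  define \<sigma>1 where "\<sigma>1 = low_slope (Suc j) l (Suc k)"
  define \<sigma>0 where "\<sigma>0 = low_slope (Suc j) (Suc l) k"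
  define A where "A = real (j - l)"

  have A: "A = real j - real l" "real k \<le> A" "0 \<le> A" using jkl by (auto simp: A_def)
  have p: "1 \<le> p" using jkl by (auto simp: p_def Suc_leI)
  have q: "1 \<le> q" using jkl by (auto simp: q_def Suc_leI)
  have w: "0 \<le> w" by (simp add: w_def)
  have wp: "w * real (Suc l) = p * A"
  proof -
    have "Suc l * (j choose Suc l) = (j - l) * (j choose l)"
      by (rule binomial_Suc_ratio)
    then show ?thesis unfolding w_def p_def A_def by (metis mult.commute of_nat_mult)
  qed
  have sl: "s * (A + 1) = p * real l"
  proof (cases l)
    case (Suc m)
    have "Suc m * (j choose Suc m) = (j - m) * (j choose m)"
      by (rule binomial_Suc_ratio)
    moreover have "real (j - m) = A + 1" using Suc A jkl by auto
    moreover have "s = real (j choose m)" by (simp add: s_def p_def Suc)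
    ultimately show ?thesis unfolding p_def Suc by (metis mult.commute of_nat_mult)
  qed (simp add: s_def p_def)
  have vk: "v * (real j + 1 - real k) = q * real k"
  proof (cases k)
    case (Suc m)
    have "Suc m * (j choose Suc m) = (j - m) * (j choose m)"
      by (rule binomial_Suc_ratio)
    moreover have "real (j - m) = real j + 1 - real k" using Suc jkl by auto
    moreover have "v = real (j choose m)" by (simp add: v_def q_def Suc)
    ultimately show ?thesis unfolding q_def Suc by (metis mult.commute of_nat_mult)
  qed (simp add: v_def q_def)

  have F1: "0 < l \<Longrightarrow> \<alpha> \<le> \<sigma>" "2 \<le> l \<Longrightarrow> \<sigma> \<le> \<sigma>1"
    using low_slope_link_ge[OF jkl] by (auto simp: \<alpha>_def \<sigma>_def \<sigma>1_def p_def q_def)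
  have F2: "real k * \<sigma> \<le> A * \<sigma>0"
    using low_slope_deletion_ge[OF jkl] by (auto simp: \<sigma>_def \<sigma>0_def A_def)
  have F3: "0 < l \<Longrightarrow> \<sigma> * (A + 1 - real k) \<le> u"
    using low_slope_le[OF jkl] jkl by (auto simp: \<sigma>_def u_def A_def Suc_diff_le of_nat_diff algebra_simps)

  have \<sigma>: "\<sigma> * (p + s - 1) = z + q - e"
  proof -
    let ?X = "\<Sum>i<l. real ((j - i) choose k)" and ?Y = "\<Sum>i<l. real ((j - i) choose (l - i))"
    have lj: "l \<le> j" using jkl by simp
    have X: "?X = z + q - e"
      using sum_binomial_lower[OF lj, of k] lj by (simp add: z_def q_def e_def Suc_diff_le)
    have Y: "?Y = p + s - 1"
      using sum_binomial_diagonal[OF lj] by (simp add: s_def)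
    have "\<sigma> * ?Y = ?X"
      using low_slope_eq[OF lj, of k] sum_diagonal_pos[OF _ lj] by (cases "l = 0") (auto simp: \<sigma>_def)
    then show ?thesis unfolding X Y .
  qed
  have s_cases: "s = 0 \<and> l = 0 \<or> s = 1 \<and> l = 1 \<or> 1 < s \<and> 2 \<le> l"
  proof (cases l)
    case (Suc m)
    then have "s = real (j choose m)" by (simp add: s_def p_def)
    then show ?thesis using Suc binomial_gt_1[of m j] jkl by (cases "m = 0") auto
  qed (simp add: s_def p_def)
  have \<sigma>1: "1 \<le> s \<Longrightarrow> \<sigma>1 * (s - 1) = z - e"
    using s_cases by (auto simp: \<sigma>1_def low_slope_def z_def e_def s_def p_def)
  have \<sigma>0: "\<sigma>0 * (p - 1) = q - u"
  proof (cases "p = 1")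
    case True
    then have "\<not> (0 < l \<and> l < j)"
      using binomial_gt_1[of l j] by (auto simp: p_def)
    then have "l = 0 \<or> j = l \<and> k = 0" using jkl by linarith
    then show ?thesis using True by (auto simp: q_def u_def)
  next
    case False
    then show ?thesis by (simp add: \<sigma>0_def low_slope_def q_def u_def p_def)
  qed
  have qu: "q \<le> p * u"
    using binomial_le_mult[OF jkl] unfolding p_def q_def u_def by (metis of_nat_le_iff of_nat_mult)
  \<comment> \<open>The chord from \<open>(1, u)\<close> to \<open>(p, q)\<close> is no steeper than
    the ray from the origin to \<open>(p, q)\<close>; this amounts to
    \<open>q \<le> p * u\<close>.\<close>
  have F4: "\<sigma>0 \<le> \<alpha>"
  proof (cases "p = 1")
    case True
    then show ?thesis using p q by (simp add: \<sigma>0_def low_slope_def \<alpha>_def p_def)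
  next
    case False
    have "\<sigma>0 * p * (p - 1) = p * (q - u)" unfolding \<sigma>0[symmetric] by (simp only: mult_ac)
    also have "\<dots> \<le> q * (p - 1)" using qu by (simp add: algebra_simps)
    finally have "\<sigma>0 * p \<le> q" using False p by (simp add: mult_le_cancel_right)
    then show ?thesis using p by (simp add: \<alpha>_def divide_simps)
  qed
  have \<alpha>q: "\<alpha> * p = q" using p by (simp add: \<alpha>_def)

  have link_low: "e + \<sigma>1 * (real b1 - 1) \<le> y1" if "real b1 \<le> s"
    using y1 that by (simp add: disjoint_bound_def e_def \<sigma>1_def s_def p_def)
  have link_up: "z + q - \<alpha> * (p + s - real b1) \<le> y1" if "s \<le> real b1"
    using y1 that by (simp add: disjoint_bound_def up_slope_def z_def q_def \<alpha>_def s_def p_def)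
  have del_low: "u + \<sigma>0 * (real b0 - 1) \<le> y0" if "real b0 \<le> p" "0 < b0"
    using y0(1) that by (simp add: disjoint_bound_def u_def \<sigma>0_def p_def)
  have del_up: "q + v - \<beta> * (p + w - real b0) \<le> y0" if "p \<le> real b0" "0 < b0"
    using y0(1) that by (simp add: disjoint_bound_def up_slope_def v_def q_def \<beta>_def p_def w_def)
  \<comment> \<open>The ray of slope \<open>\<alpha>\<close> from the origin meets the lower segment
    at \<open>(p, q)\<close> and is at least as steep, hence lies below it to the left. It also
    covers an empty deletion.\<close>
  have del_lin: "\<alpha> * real b0 \<le> y0" if "real b0 \<le> p"
  proof (cases "b0 = 0")
    case False
    have "u + \<sigma>0 * (real b0 - 1) = q - \<sigma>0 * (p - real b0)" using \<sigma>0 by (simp add: algebra_simps)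
    moreover have "\<sigma>0 * (p - real b0) \<le> \<alpha> * (p - real b0)"
      using F4 that by (intro mult_right_mono) auto
    ultimately show ?thesis using del_low[OF that] False \<alpha>q by (simp add: algebra_simps)
  qed (use y0(2) in simp)

  have degA: "real (Suc l) * real b0 \<le> (A + 1) * real b1"
  proof -
    have "real (Suc l * (b1 + b0)) \<le> real (Suc (Suc j) * b1)" using deg by (simp only: of_nat_le_iff)
    then show ?thesis unfolding A(1) by (simp add: algebra_simps)
  qed

  have low: "e + \<sigma> * (real b1 + real b0 - 1) \<le> y1 + y0" if b: "real b1 + real b0 \<le> p + s"
  proof (cases "s \<le> real b1")
    case True
    have b0p: "real b0 \<le> p"
    proof -
      have "(A + 1) * (real b1 + real b0) \<le> (A + 1) * (p + s)"
        using b A by (intro mult_left_mono) auto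
      then have "(A + 2 + real l) * real b0 \<le> (A + 1 + real l) * p"
        using degA sl by (simp add: algebra_simps)
      also have "\<dots> \<le> (A + 2 + real l) * p" using p by (simp add: mult_right_mono)
      finally show ?thesis using A by (simp add: mult_le_cancel_left)
    qed
    \<comment> \<open>Both parts are now bounded with slope \<open>\<alpha>\<close>, so their sum
      lies on a line through \<open>(p + s, z + q)\<close>. The target line passes through the same
      point with slope \<open>\<sigma>\<close>, which is at least \<open>\<alpha>\<close> for
      \<open>l > 0\<close>.\<close>
    have "(\<sigma> - \<alpha>) * (p + s - (real b1 + real b0)) \<ge> 0"
    proof (cases "l = 0")
      case True
      then have "p + s - (real b1 + real b0) = 0"
        using b b1 by (simp add: p_def s_def)
      then show ?thesis by simp
    next
      case False
      then show ?thesis using F1(1) b by (intro mult_nonneg_nonneg) auto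
    qed
    then show ?thesis using link_up[OF True] del_lin[OF b0p] \<sigma> by (simp add: algebra_simps)
  next
    case False
    then have bs: "real b1 < s" by simp
    then have s: "1 < s" "2 \<le> l" using s_cases b1(1) by auto
    note link = link_low[OF less_imp_le[OF bs]]
    show ?thesis
    proof (cases "b0 = 0")
      case True
      have "\<sigma> * (real b1 - 1) \<le> \<sigma>1 * (real b1 - 1)"
        using F1(2) s b1 by (intro mult_right_mono) auto
      then show ?thesis using link y0(2) True by simp
    next
      case False
      define D where "D = \<sigma> - \<sigma>0"
      have D: "0 \<le> D" using F1(1) F4 s by (auto simp: D_def)
      have b0le: "real b0 * real (Suc l) \<le> (A + 1) * real b1" using degA by (simp add: mult.commute)
      have b0p: "real b0 \<le> p"
      proof -
        have "(A + 1) * real b1 \<le> (A + 1) * s" using bs A by (intro mult_left_mono) auto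
        also have "\<dots> \<le> real (Suc l) * p" using sl p by (simp add: algebra_simps)
        finally have "real (Suc l) * real b0 \<le> real (Suc l) * p" by (rule order_trans[OF degA])
        then show ?thesis by (simp add: mult_le_cancel_left del: of_nat_Suc)
      qed
      have at_1: "D * (A + 1) \<le> u - \<sigma>0"
        using F2 F3 s by (simp add: D_def algebra_simps)
      \<comment> \<open>Equality, because the lower segments of link, deletion and whole family end
        at \<open>(s, z)\<close>, \<open>(p, q)\<close> and their sum
        \<open>(p + s, z + q)\<close>.\<close>
      have at_s: "(\<sigma>1 - \<sigma>) * (s - 1) + (u - \<sigma>0) = D * p"
        using \<sigma> \<sigma>1 \<sigma>0 s by (simp add: D_def algebra_simps)
      \<comment> \<open>The claim is equivalent to \<open>D * real b0 \<le> ?h (real b1)\<close>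
        once the two lower bounds are added.\<close>
      let ?h = "\<lambda>x. (\<sigma>1 - \<sigma>) * (x - 1) + (u - \<sigma>0)"
      have "D * real b0 * (s - 1) \<le> ?h (real b1) * (s - 1)"
      proof -
        \<comment> \<open>Weakening \<open>l + 1\<close> to \<open>l\<close> in the degree condition
          gives a ray through \<open>(s, p)\<close>, by \<open>sl\<close>. For \<open>b1\<close>
          between \<open>1\<close> and \<open>s\<close> it stays below the chord from
          \<open>(1, A + 1)\<close> to \<open>(s, p)\<close>, whose ends are treated by
          \<open>at_1\<close> and \<open>at_s\<close>.\<close>
        have "real l * (real b0 * (s - 1)) \<le> (A + 1) * real b1 * (s - 1)"
          using degA s by (simp add: mult_right_mono flip: mult.assoc) (simp add: algebra_simps)
        also have "\<dots> \<le> (A + 1) * ((real b1 - 1) * s + real l * (s - real b1))"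
        proof -
          have "0 \<le> (real l - 1) * (s - real b1)" using s bs by (intro mult_nonneg_nonneg) auto
          then have "real b1 * (s - 1) \<le> (real b1 - 1) * s + real l * (s - real b1)"
            by (simp add: algebra_simps)
          then show ?thesis using A by (simp add: mult.assoc mult_left_mono)
        qed
        also have "\<dots> = (real b1 - 1) * (s * (A + 1)) + real l * ((s - real b1) * (A + 1))"
          by (simp add: algebra_simps)
        also have "\<dots> = real l * ((real b1 - 1) * p + (s - real b1) * (A + 1))"
          unfolding sl by (simp add: algebra_simps)
        finally have "real b0 * (s - 1) \<le> (real b1 - 1) * p + (s - real b1) * (A + 1)"
          using s by (simp add: mult_le_cancel_left)
        then have "D * (real b0 * (s - 1)) \<le> D * ((real b1 - 1) * p + (s - real b1) * (A + 1))"
          using D by (rule mult_left_mono)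
        also have "\<dots> = (real b1 - 1) * (D * p) + (s - real b1) * (D * (A + 1))"
          by (simp add: algebra_simps)
        also have "\<dots> \<le> (real b1 - 1) * (D * p) + (s - real b1) * (u - \<sigma>0)"
          using at_1 bs by (intro add_left_mono mult_left_mono) auto
        also have "\<dots> = ?h (real b1) * (s - 1)"
          unfolding at_s[symmetric] by (simp add: algebra_simps)
        finally show ?thesis by (simp add: mult.assoc)
      qed
      then have "D * real b0 \<le> ?h (real b1)" using s by simp
      then show ?thesis using link del_low[OF b0p] False by (simp add: D_def algebra_simps)
    qed
  qed

  have up: "z + q + (q + v) - \<gamma> * (p + s + (p + w) - (real b1 + real b0)) \<le> y1 + y0"
    if b: "p + s \<le> real b1 + real b0"
  proof -
    have \<gamma>: "\<gamma> * (p + w) = q + v" using p w by (simp add: \<gamma>_def)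
    \<comment> \<open>This makes \<open>\<gamma>\<close>, the mediant of \<open>\<alpha>\<close> and
      \<open>\<beta>\<close>, at most \<open>\<alpha>\<close>.\<close>
    have vpqw: "v * p \<le> q * w"
    proof -
      let ?c = "real j + 1 - real k"
      have c: "real l + 1 \<le> ?c" using jkl by linarith
      have "v * p * (?c * (real l + 1)) = (v * ?c) * p * (real l + 1)" by (simp only: mult_ac)
      also have "\<dots> = (q * p) * (real k * (real l + 1))" unfolding vk by (simp only: mult_ac)
      also have "\<dots> \<le> (q * p) * (A * ?c)"
        using c A p q by (intro mult_left_mono mult_mono) auto
      also have "\<dots> = q * (p * A) * ?c" by (simp only: mult_ac)
      also have "\<dots> = q * w * (?c * (real l + 1))" unfolding wp[symmetric] by (simp add: mult_ac)
      finally show ?thesis using c by (simp add: mult_le_cancel_right)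
    qed
    have \<gamma>\<alpha>: "\<gamma> \<le> \<alpha>"
      using vpqw p w by (simp add: \<gamma>_def \<alpha>_def divide_simps algebra_simps)
    have sb1: "s \<le> real b1"
    proof -
      have "real (Suc l) * (p + s) \<le> real (Suc l) * (real b1 + real b0)"
        using b by (intro mult_left_mono) auto
      then have "(A + 2 + real l) * s \<le> (A + 2 + real l) * real b1"
        using degA sl p by (simp add: algebra_simps)
      then show ?thesis using A by (simp add: mult_le_cancel_left)
    qed
    show ?thesis
    proof (cases "real b0 \<le> p")
      case True
      have "0 \<le> (\<alpha> - \<gamma>) * (real b1 + real b0 - (p + s))"
        using \<gamma>\<alpha> b by (intro mult_nonneg_nonneg) auto
      then show ?thesis
        using link_up[OF sb1] del_lin[OF True] \<gamma> by (simp add: algebra_simps)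
    next
      case False
      \<comment> \<open>Deficits from the full link and the full deletion. The full families attain
        equality in the degree condition, so \<open>degA\<close> turns into the reverse inequality
        \<open>dd\<close> for the deficits.\<close>
      define d1 where "d1 = p + s - real b1"
      define d0 where "d0 = p + w - real b0"
      have d: "0 \<le> d1" "0 \<le> d0"
        using b1(2) b0 by (simp_all add: d1_def d0_def s_def p_def w_def flip: of_nat_add)
      have dd: "(A + 1) * d1 \<le> real (Suc l) * d0"
        using degA sl wp by (simp add: d1_def d0_def algebra_simps)
      have "(\<alpha> - \<gamma>) * d1 \<le> (\<gamma> - \<beta>) * d0"
      proof (cases "w = 0")
        case True
        moreover have "0 \<le> v" by (cases k) (simp_all add: v_def q_def)
        ultimately have "v = 0" using vpqw p by (simp add: mult_le_0_iff)
        then show ?thesis using True d p q by (simp add: \<alpha>_def \<beta>_def \<gamma>_def)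
      next
        case False
        then have w: "0 < w" using w by simp
        have "w * d1 * real (Suc l) = p * (A * d1)" using wp by (simp add: mult_ac)
        also have "\<dots> \<le> p * (real (Suc l) * d0)"
          using dd d p by (intro mult_left_mono) (auto simp: algebra_simps)
        finally have "w * d1 * real (Suc l) \<le> p * d0 * real (Suc l)" by (simp only: mult_ac)
        then have wd: "w * d1 \<le> p * d0" by (simp add: mult_le_cancel_right del: of_nat_Suc)
        \<comment> \<open>The two slope gaps are in the ratio \<open>w\<close> to \<open>p\<close>,
          so \<open>wd\<close> is exactly what is needed.\<close>
        have "\<alpha> - \<gamma> = (q * w - v * p) / (p * (p + w))"
          using p w by (simp add: \<alpha>_def \<gamma>_def divide_simps) (simp add: algebra_simps)
        moreover have "\<gamma> - \<beta> = (q * w - v * p) / (w * (p + w))"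
          using p w by (simp add: \<beta>_def \<gamma>_def divide_simps) (simp add: algebra_simps)
        moreover have "d1 / (p * (p + w)) \<le> d0 / (w * (p + w))"
          using wd p w by (simp add: divide_simps mult_ac)
        then have "(q * w - v * p) * (d1 / (p * (p + w))) \<le> (q * w - v * p) * (d0 / (w * (p + w)))"
          using vpqw by (intro mult_left_mono) auto
        ultimately show ?thesis by simp
      qed
      then show ?thesis
        using link_up[OF sb1] del_up False p \<gamma> by (simp add: d1_def d0_def algebra_simps)
    qed
  qed
  have "real (Suc (Suc j) choose Suc l) = p + s + (p + w)" "real (Suc j choose Suc l) = p + w"
    by (simp_all add: p_def s_def w_def)
  moreover have "real (Suc (Suc j) choose Suc k) = z + q + (q + v)" "real (Suc j choose Suc k) = z + q"
    by (simp_all add: z_def q_def v_def)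
  ultimately show ?thesis
    using low up unfolding disjoint_bound_def up_slope_def \<sigma>_def \<gamma>_def
    by (simp add: e_def del: binomial_Suc_Suc)
qed

section \<open>Counting sets disjoint from a member of a family\<close>

definition disjoint_sets_to :: "'a set \<Rightarrow> nat \<Rightarrow> 'a set set \<Rightarrow> 'a set set" where
  "disjoint_sets_to V k B = {S \<in> nsets V k. \<exists>T\<in>B. S \<inter> T = {}}"

lemma finite_disjoint_sets_to: "finite V \<Longrightarrow> finite (disjoint_sets_to V k B)"
  by (simp add: disjoint_sets_to_def finite_imp_finite_nsets)

text \<open>Double counting of incidences: the degrees sum to \<open>l * card B\<close>, so they
  cannot all be below average.\<close>

lemma exists_large_degree:
  assumes "finite V" "V \<noteq> {}" "B \<subseteq> nsets V l"
  shows "\<exists>x\<in>V. l * card B \<le> card V * card {T \<in> B. x \<in> T}"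
proof (rule ccontr)
  assume "\<not> ?thesis"
  then have less: "card V * card {T \<in> B. x \<in> T} < l * card B" if "x \<in> V" for x
    using that by force
  have finB: "finite B" using assms finite_imp_finite_nsets finite_subset by blast
  have "(\<Sum>x\<in>V. card {T \<in> B. x \<in> T}) = (\<Sum>T\<in>B. card {x \<in> V. x \<in> T})"
    by (rule sum_multicount_gen) (use assms(1) finB in auto)
  also have "\<dots> = (\<Sum>T\<in>B. l)"
  proof (rule sum.cong)
    fix T assume "T \<in> B"
    then have "{x \<in> V. x \<in> T} = T" "card T = l" using assms(3) by (auto simp: nsets_def)
    then show "card {x \<in> V. x \<in> T} = l" by simp
  qed simp
  finally have sum: "(\<Sum>x\<in>V. card {T \<in> B. x \<in> T}) = l * card B" by simp
  have "(\<Sum>x\<in>V. card V * card {T \<in> B. x \<in> T}) < (\<Sum>x\<in>V. l * card B)"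
    by (rule sum_strict_mono) (use assms less in auto)
  then show False using sum by (simp flip: sum_distrib_left)
qed

text \<open>A set avoiding \<open>x\<close> is disjoint from \<open>T\<close> as soon as it is
  disjoint from \<open>T - {x}\<close>, and adding \<open>x\<close> to a set keeps it disjoint from
  any \<open>T\<close> avoiding \<open>x\<close>. The two kinds are separated by membership of
  \<open>x\<close>.\<close>

lemma card_disjoint_sets_to_split:
  assumes "finite V" "x \<in> V"
  shows "card (disjoint_sets_to (V - {x}) (Suc k) ((\<lambda>T. T - {x}) ` {T \<in> B. x \<in> T}))
    + card (disjoint_sets_to (V - {x}) k {T \<in> B. x \<notin> T}) \<le> card (disjoint_sets_to V (Suc k) B)"
    (is "card ?L + card ?D \<le> card ?N")
proof -
  have "card ?L + card ?D = card ?L + card (insert x ` ?D)"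
    by (subst card_image) (auto simp: inj_on_def disjoint_sets_to_def nsets_def)
  also have "\<dots> = card (?L \<union> insert x ` ?D)"
  proof (rule card_Un_disjoint[symmetric])
    show "?L \<inter> insert x ` ?D = {}" by (auto simp: disjoint_sets_to_def nsets_def)
  qed (use assms finite_disjoint_sets_to in blast)+
  also have "\<dots> \<le> card ?N"
  proof (rule card_mono)
    show "?L \<union> insert x ` ?D \<subseteq> ?N"
    proof (rule Un_least; rule subsetI)
      fix S assume "S \<in> ?L"
      then obtain T where "S \<in> nsets (V - {x}) (Suc k)" "T \<in> B" "S \<inter> (T - {x}) = {}"
        by (auto simp: disjoint_sets_to_def)
      moreover from this have "S \<inter> T = {}" "S \<in> nsets V (Suc k)" by (auto simp: nsets_def)
      ultimately show "S \<in> ?N" by (auto simp: disjoint_sets_to_def)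
    next
      fix S assume "S \<in> insert x ` ?D"
      then obtain S' T where "S = insert x S'" "S' \<in> nsets (V - {x}) k" "T \<in> B" "x \<notin> T" "S' \<inter> T = {}"
        by (auto simp: disjoint_sets_to_def)
      moreover from this have "S \<in> nsets V (Suc k)"
        using assms(2) by (auto simp: nsets_def card_insert_if)
      ultimately show "S \<in> ?N" by (auto simp: disjoint_sets_to_def)
    qed
  qed (use assms finite_disjoint_sets_to in blast)
  finally show ?thesis .
qed

lemma disjoint_bound_card:
  assumes "finite V" "k + l \<le> card V" "B \<subseteq> nsets V l" "B \<noteq> {}"
  shows "disjoint_bound (card V) l k (real (card B)) (real (card (disjoint_sets_to V k B)))"
  using assms
proof (induction "card V" arbitrary: V k l B rule: less_induct)
  case less
  have finB: "finite B" using less.prems finite_imp_finite_nsets finite_subset by blast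
  show ?case
  proof (cases "k = 0 \<or> l = 0")
    case True
    then show ?thesis
    proof
      assume k: "k = 0"
      have "disjoint_sets_to V 0 B = {{}}"
        using less.prems(4) by (auto simp: disjoint_sets_to_def nsets_def)
      then show ?thesis by (simp add: k disjoint_bound_def low_slope_def up_slope_def)
    next
      assume l: "l = 0"
      then have "B = {{}}" using less.prems(3,4) by (auto simp: nsets_def)
      moreover from this have "disjoint_sets_to V k B = nsets V k"
        by (auto simp: disjoint_sets_to_def)
      ultimately show ?thesis using less.prems(1) by (simp add: l disjoint_bound_def card_nsets)
    qed
  next
    case False
    then obtain k' l' where kl: "k = Suc k'" "l = Suc l'" by (metis not0_implies_Suc)
    define j where "j = card V - 2"
    have j: "card V = Suc (Suc j)" "k' + l' \<le> j" using less.prems(2) kl by (auto simp: j_def)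
    then have "V \<noteq> {}" by auto
    then obtain x where x: "x \<in> V" "l * card B \<le> card V * card {T \<in> B. x \<in> T}"
      using exists_large_degree[OF less.prems(1) _ less.prems(3)] by blast
    define B1 where "B1 = (\<lambda>T. T - {x}) ` {T \<in> B. x \<in> T}"
    define B0 where "B0 = {T \<in> B. x \<notin> T}"
    let ?W = "V - {x}"
    have W: "finite ?W" "card ?W = Suc j" using less.prems(1) x(1) j(1) by auto
    have cB1: "card B1 = card {T \<in> B. x \<in> T}"
      unfolding B1_def by (rule card_image) (auto simp: inj_on_def)
    have cB: "card B = card B1 + card B0"
    proof -
      have "B = {T \<in> B. x \<in> T} \<union> B0" by (auto simp: B0_def)
      moreover have "card ({T \<in> B. x \<in> T} \<union> B0) = card {T \<in> B. x \<in> T} + card B0"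
        by (rule card_Un_disjoint) (use finB in \<open>auto simp: B0_def\<close>)
      ultimately show ?thesis using cB1 by simp
    qed
    have sub1: "B1 \<subseteq> nsets ?W l'" and sub0: "B0 \<subseteq> nsets ?W l"
      using less.prems(3) kl by (auto simp: B1_def B0_def nsets_def)
    \<comment> \<open>The link is non-empty by the choice of \<open>x\<close>, so its induction
      hypothesis always applies; the deletion may be empty.\<close>
    have b1: "0 < card B1"
    proof -
      have "0 < l * card B" using finB less.prems(4) kl by (simp add: card_gt_0_iff)
      then have "0 < card V * card {T \<in> B. x \<in> T}" using x(2) by (rule less_le_trans)
      then show ?thesis unfolding cB1 by simp
    qed
    then have ne1: "B1 \<noteq> {}" by auto
    have IH1: "disjoint_bound (Suc j) l' (Suc k') (real (card B1)) (real (card (disjoint_sets_to ?W (Suc k') B1)))"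
      using less.hyps[OF _ W(1) _ sub1 ne1, of "Suc k'"] W(2) j by simp
    have IH0: "disjoint_bound (Suc j) (Suc l') k' (real (card B0)) (real (card (disjoint_sets_to ?W k' B0)))"
      if "0 < card B0"
      using less.hyps[OF _ W(1) _ sub0, of k'] W(2) j kl that by (auto simp: card_gt_0_iff)
    have "disjoint_bound (Suc (Suc j)) (Suc l') (Suc k') (real (card B1 + card B0))
      (real (card (disjoint_sets_to ?W (Suc k') B1)) + real (card (disjoint_sets_to ?W k' B0)))"
    proof (rule disjoint_bound_step[OF j(2) _ _ _ _ IH1 IH0])
      show "card B1 \<le> (Suc j choose l')"
        using card_mono[OF _ sub1] W by (simp add: card_nsets finite_imp_finite_nsets)
      show "card B0 \<le> (Suc j choose Suc l')"
        using card_mono[OF _ sub0] W by (simp add: card_nsets finite_imp_finite_nsets kl del: binomial_Suc_Suc)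
      show "Suc l' * (card B1 + card B0) \<le> Suc (Suc j) * card B1"
        using x(2) unfolding j(1) kl cB cB1 .
    qed (use b1 in auto)
    moreover have "real (card (disjoint_sets_to ?W (Suc k') B1)) + real (card (disjoint_sets_to ?W k' B0))
        \<le> real (card (disjoint_sets_to V k B))"
      using card_disjoint_sets_to_split[OF less.prems(1) x(1), of k' B]
      unfolding kl B1_def B0_def by linarith
    ultimately show ?thesis
      unfolding disjoint_bound_def j(1) kl cB by fastforce
  qed
qed

section \<open>Weighted bound for two cross-intersecting families\<close>

lemma cross_intersecting_pair_le:
  fixes A B :: "nat set set"
  assumes "0 < k" "2 * k \<le> n"
    and A: "A \<subseteq> nsets {1..n} k" and B: "B \<subseteq> nsets {1..n} k" "B \<noteq> {}"
    and cross: "\<And>S T. S \<in> A \<Longrightarrow> T \<in> B \<Longrightarrow> S \<inter> T \<noteq> {}"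
    and le: "card B \<le> card A"
  shows "card A + c * card B
    \<le> max ((n choose k) - ((n - k) choose k) + c) ((c + 1) * ((n - 1) choose (k - 1)))"
proof -
  define N where "N = real ((n - 1) choose (k - 1))"
  define M where "M = real ((n - 1) choose k)"
  define f where "f = real (n choose k) - real ((n - k) choose k)"
  define \<sigma> where "\<sigma> = low_slope n k k"
  define a where "a = real (card A)"
  define b where "b = real (card B)"
  define y where "y = real (card (disjoint_sets_to {1..n} k B))"
  obtain n' k' where nk: "n = Suc n'" "k = Suc k'" "k' < n'" using assms(1,2) by (cases n; cases k) auto
  have NM: "real (n choose k) = N + M" by (simp add: N_def M_def nk)
  have N: "1 \<le> N" and M: "1 \<le> M" using nk by (auto simp: N_def M_def Suc_leI)
  have bound: "disjoint_bound n k k b y"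
    using disjoint_bound_card[of "{1..n}" k k B] B assms(2) by (simp add: b_def y_def)
  have "A \<inter> disjoint_sets_to {1..n} k B = {}"
    using cross by (auto simp: disjoint_sets_to_def)
  then have "card A + card (disjoint_sets_to {1..n} k B) = card (A \<union> disjoint_sets_to {1..n} k B)"
    using finite_subset[OF A] finite_imp_finite_nsets finite_disjoint_sets_to
    by (intro card_Un_disjoint[symmetric]) blast+
  also have "\<dots> \<le> card (nsets {1..n} k)"
    by (rule card_mono) (use A in \<open>auto simp: disjoint_sets_to_def finite_imp_finite_nsets\<close>)
  finally have ay: "a + y \<le> N + M"
    using NM by (simp add: a_def y_def card_nsets flip: of_nat_add)
  have b1: "1 \<le> b"
    using B finite_subset[OF B(1)] by (auto simp: b_def Suc_le_eq card_gt_0_iff finite_imp_finite_nsets)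
  \<comment> \<open>Beyond the star size \<open>N\<close> the upper segment gives
    \<open>y \<ge> M\<close>, hence \<open>a \<le> N < b\<close>, against
    \<open>card B \<le> card A\<close>.\<close>
  have bN: "b \<le> N"
  proof (rule ccontr)
    assume "\<not> b \<le> N"
    then have "N + M - N / M * (N + M - b) \<le> y"
      using bound NM by (simp add: disjoint_bound_def up_slope_def N_def M_def)
    moreover have "N / M * (N + M - b) \<le> N / M * M"
      using \<open>\<not> b \<le> N\<close> N M by (intro mult_left_mono) auto
    ultimately have "a \<le> N" using ay M by simp
    then show False using le \<open>\<not> b \<le> N\<close> by (simp add: a_def b_def)
  qed
  have "a + \<sigma> * (b - 1) \<le> f"
    using bound NM ay bN by (simp add: disjoint_bound_def f_def \<sigma>_def N_def M_def)
  moreover have \<sigma>: "\<sigma> * (N - 1) = f - N"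
  proof (cases "N = 1")
    case True
    then have "k' = 0" using binomial_gt_1[of k' n'] nk by (auto simp: N_def)
    then show ?thesis using True nk by (simp add: f_def)
  next
    case False
    then show ?thesis using NM by (simp add: \<sigma>_def low_slope_def f_def N_def M_def)
  qed
  \<comment> \<open>The bound on \<open>a + real c * b\<close> is linear in \<open>b\<close> with
    coefficient \<open>real c - \<sigma>\<close>; the sign decides between the ends
    \<open>b = N\<close> and \<open>b = 1\<close>.\<close>
  ultimately have "a + real c * b \<le> max (f + real c) ((real c + 1) * N)"
  proof (cases "\<sigma> \<le> real c")
    case True
    have "(real c - \<sigma>) * (b - 1) \<le> (real c - \<sigma>) * (N - 1)"
      using True bN by (intro mult_left_mono) auto
    then have "a + real c * b \<le> (real c + 1) * N"
      using \<open>a + \<sigma> * (b - 1) \<le> f\<close> \<sigma> by (simp add: algebra_simps)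
    then show ?thesis by simp
  next
    case False
    have "0 \<le> (\<sigma> - real c) * (b - 1)"
      using False b1 by (intro mult_nonneg_nonneg) auto
    then have "a + real c * b \<le> f + real c"
      using \<open>a + \<sigma> * (b - 1) \<le> f\<close> by (simp add: algebra_simps)
    then show ?thesis by simp
  qed
  moreover have "f = real ((n choose k) - ((n - k) choose k))"
    by (simp add: f_def of_nat_diff binomial_right_mono)
  ultimately have "real (card A + c * card B)
      \<le> real (max ((n choose k) - ((n - k) choose k) + c) ((c + 1) * ((n - 1) choose (k - 1))))"
    by (simp add: a_def b_def N_def of_nat_max algebra_simps)
  then show ?thesis by (simp only: of_nat_le_iff)
qed

section \<open>Sum over all families, and sharpness\<close>

theorem corollary1p5:
  fixes n k t :: nat
  assumes "n > 0" and "k > 0" and "n \<ge> 2 * k" and "t \<ge> 2"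
  shows "(\<forall>\<A>. nonempty_cross_intersecting_families n k t \<A> \<longrightarrow>
            (\<Sum>i = 1..t. card (\<A> i))
              \<le> max ((n choose k) - ((n - k) choose k) + t - 1) (t * ((n - 1) choose (k - 1))))
       \<and> (\<exists>\<A>. nonempty_cross_intersecting_families n k t \<A> \<and>
            (\<Sum>i = 1..t. card (\<A> i))
              = max ((n choose k) - ((n - k) choose k) + t - 1) (t * ((n - 1) choose (k - 1))))"
proof (intro conjI allI impI)
  fix \<A> assume \<A>: "nonempty_cross_intersecting_families n k t \<A>"
  obtain i where i: "i \<in> {1..t}" "\<And>h. h \<in> {1..t} \<Longrightarrow> card (\<A> h) \<le> card (\<A> i)"
  proof -
    have "Max ((\<lambda>h. card (\<A> h)) ` {1..t}) \<in> (\<lambda>h. card (\<A> h)) ` {1..t}"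
      using assms(4) by (intro Max_in) auto
    then obtain i where "i \<in> {1..t}" "card (\<A> i) = Max ((\<lambda>h. card (\<A> h)) ` {1..t})" by auto
    then show ?thesis by (intro that[of i]) auto
  qed
  let ?R = "{1..t} - {i}"
  have R: "finite ?R" "card ?R = t - 1" using i(1) by auto
  then have "?R \<noteq> {}" using assms(4) by (intro notI) (simp only: card.empty)
  note R = R this
  obtain j where j: "j \<in> ?R" "\<And>h. h \<in> ?R \<Longrightarrow> card (\<A> h) \<le> card (\<A> j)"
  proof -
    have "Max ((\<lambda>h. card (\<A> h)) ` ?R) \<in> (\<lambda>h. card (\<A> h)) ` ?R"
      using R by (intro Max_in) auto
    then obtain j where "j \<in> ?R" "card (\<A> j) = Max ((\<lambda>h. card (\<A> h)) ` ?R)"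
      by (metis (no_types, lifting) imageE)
    then show ?thesis using R(1) by (intro that[of j]) auto
  qed
  have "(\<Sum>h = 1..t. card (\<A> h)) = card (\<A> i) + (\<Sum>h\<in>?R. card (\<A> h))"
    using i(1) by (simp add: sum.remove)
  also have "\<dots> \<le> card (\<A> i) + (t - 1) * card (\<A> j)"
    using sum_bounded_above[of ?R "\<lambda>h. card (\<A> h)" "card (\<A> j)"] j(2) R(2) by simp
  also have "\<dots> \<le> max ((n choose k) - ((n - k) choose k) + (t - 1)) ((t - 1 + 1) * ((n - 1) choose (k - 1)))"
  proof (rule cross_intersecting_pair_le)
    show "card (\<A> j) \<le> card (\<A> i)" using i(2) j(1) by simp
    show "\<A> i \<subseteq> nsets {1..n} k" "\<A> j \<subseteq> nsets {1..n} k" "\<A> j \<noteq> {}"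
      using \<A> i(1) j(1) by (auto simp: nonempty_cross_intersecting_families_def)
    show "S \<inter> T \<noteq> {}" if "S \<in> \<A> i" "T \<in> \<A> j" for S T
      using \<A> i(1) j(1) that
      unfolding nonempty_cross_intersecting_families_def cross_intersecting_def by blast
  qed (use assms in auto)
  finally show "(\<Sum>i = 1..t. card (\<A> i))
      \<le> max ((n choose k) - ((n - k) choose k) + t - 1) (t * ((n - 1) choose (k - 1)))"
    using assms(4) by simp
next
  let ?K = "{1..k}" and ?V = "{1..n}"
  \<comment> \<open>Two extremal configurations, one for each term of the maximum: all
    \<open>k\<close>-sets meeting \<open>?K\<close> with \<open>t - 1\<close> copies of
    \<open>{?K}\<close>, and \<open>t\<close> copies of the star at \<open>1\<close>.\<close>
  define \<F> where "\<F> = (\<lambda>i::nat. if i = 1 then {S \<in> nsets ?V k. S \<inter> ?K \<noteq> {}} else {?K})"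
  define \<G> where "\<G> = (\<lambda>i::nat. {S \<in> nsets ?V k. 1 \<in> S})"
  have K: "?K \<in> nsets ?V k" using assms by (auto simp: nsets_def)
  have \<F>: "nonempty_cross_intersecting_families n k t \<F>"
    using K assms(2) unfolding nonempty_cross_intersecting_families_def cross_intersecting_def \<F>_def
    by (auto simp: Int_commute)
  have \<G>: "nonempty_cross_intersecting_families n k t \<G>"
    using K assms(2) unfolding nonempty_cross_intersecting_families_def cross_intersecting_def \<G>_def
    by fastforce
  have "card {S \<in> nsets ?V k. S \<inter> ?K \<noteq> {}} = (n choose k) - ((n - k) choose k)"
  proof -
    have "{S \<in> nsets ?V k. S \<inter> ?K \<noteq> {}} = nsets ?V k - nsets (?V - ?K) k"
      by (auto simp: nsets_def)
    moreover have "card (?V - ?K) = n - k" using assms by (subst card_Diff_subset) auto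
    moreover have "nsets (?V - ?K) k \<subseteq> nsets ?V k" by (auto simp: nsets_def)
    ultimately show ?thesis
      by (simp add: card_Diff_subset finite_imp_finite_nsets card_nsets)
  qed
  then have card_\<F>1: "card (\<F> 1) = (n choose k) - ((n - k) choose k)" by (simp add: \<F>_def)
  have sum_\<F>: "(\<Sum>i = 1..t. card (\<F> i)) = (n choose k) - ((n - k) choose k) + t - 1"
  proof -
    have "(\<Sum>i = 1..t. card (\<F> i)) = card (\<F> 1) + (\<Sum>i = Suc 1..t. card (\<F> i))"
      using assms(4) by (intro sum.atLeast_Suc_atMost) simp
    also have "(\<Sum>i = Suc 1..t. card (\<F> i)) = (\<Sum>i = Suc 1..t. 1)"
      by (rule sum.cong) (auto simp: \<F>_def)
    finally show ?thesis using card_\<F>1 assms(4) by simp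
  qed
  have "card {S \<in> nsets ?V k. 1 \<in> S} = (n - 1) choose (k - 1)"
  proof -
    have "{S \<in> nsets ?V k. 1 \<in> S} = insert 1 ` nsets (?V - {1}) (k - 1)"
    proof (intro equalityI subsetI)
      fix S assume "S \<in> {S \<in> nsets ?V k. 1 \<in> S}"
      then have "S = insert 1 (S - {1})" "S - {1} \<in> nsets (?V - {1}) (k - 1)"
        by (auto simp: nsets_def)
      then show "S \<in> insert 1 ` nsets (?V - {1}) (k - 1)" by blast
    next
      fix S assume "S \<in> insert 1 ` nsets (?V - {1}) (k - 1)"
      then show "S \<in> {S \<in> nsets ?V k. 1 \<in> S}"
        using assms(1,2) by (auto simp: nsets_def card_insert_if)
    qed
    moreover have "inj_on (insert 1) (nsets (?V - {1}) (k - 1))"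
      by (auto simp: inj_on_def nsets_def)
    ultimately show ?thesis using assms(1) by (simp add: card_image card_nsets)
  qed
  then have sum_\<G>: "(\<Sum>i = 1..t. card (\<G> i)) = t * ((n - 1) choose (k - 1))"
    by (simp add: \<G>_def)
  show "\<exists>\<A>. nonempty_cross_intersecting_families n k t \<A> \<and>
      (\<Sum>i = 1..t. card (\<A> i))
        = max ((n choose k) - ((n - k) choose k) + t - 1) (t * ((n - 1) choose (k - 1)))"
    using \<F> \<G> sum_\<F> sum_\<G> by (metis max_def)
qed

end
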